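(* Let $A\in\mathfrak p$ be a regular element, let $s\in\{0,1\}$, and let $H:\mathfrak g\to\mathbb R$ be the affine Hamiltonian $H(L)=\frac12\langle L_{\mathfrak k},L_{\mathfrak k}\rangle+\langle A,L_{\mathfrak p}\rangle$, where $L=L_{\mathfrak p}+L_{\mathfrak k}$ with $L_{\mathfrak p}\in\mathfrak p$, $L_{\mathfrak k}\in\mathfrak k$. For $\lambda\neq0$ and $L\in\mathfrak g$ put $$M_\lambda=\frac1\lambda\,(L_{\mathfrak p}-sA),\qquad L_\lambda=L_{\mathfrak p}-\lambda L_{\mathfrak k}+(\lambda^2-s)A .$$ Then along every solution $L(t)$ of the Hamiltonian equations of $H$ relative to the Lie bracket $[\ ,\ ]_s$ one has, for every $\lambda\ne0$, $$\frac{dL_\lambda}{dt}=[M_\lambda,L_\lambda],$$ where $[\ ,\ ]$ is the Lie bracket of the semisimple Lie algebra $\mathfrak g$. Consequently the spectral invariants of $L_\lambda$ are constants of motion of the Hamiltonian flow of $H$, both in the semisimple case ($s=1$) and in the semidirect case ($s=0$).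
   Context: $G$ is a connected semisimple Lie group with Lie algebra $\mathfrak g$; $\sigma\neq I$ is an involutive automorphism of $G$ with compact fixed point group $K$, and $(G,K)$ is a Riemannian symmetric pair; $\mathfrak g=\mathfrak p\oplus\mathfrak k$ is the splitting into the $-1$ eigenspace $\mathfrak p$ and $+1$ eigenspace $\mathfrak k$ of $\sigma_*$, with $[\mathfrak p,\mathfrak p]=\mathfrak k$, $[\mathfrak p,\mathfrak k]=\mathfrak p$, $[\mathfrak k,\mathfrak k]\subseteq\mathfrak k$. $\langle\ ,\ \rangle$ is a scalar multiple of the Killing form of $\mathfrak g$, positive definite on $\mathfrak k$. $A\in\mathfrak p$ is regular if $\{B\in\mathfrak p:[A,B]=0\}$ is abelian. For $A_i\in\mathfrak p$, $B_i\in\mathfrak k$ the deformed bracket on the vector space $\mathfrak g$ is $$[A_1+B_1,A_2+B_2]_s=[B_1,A_2]-[B_2,A_1]+[B_1,B_2]+s[A_1,A_2];$$ for $s=1$ it is the bracket of $\mathfrak g$, and for $s=0$ the bracket of the Lie algebra of the semidirect product $\mathfrak p\rtimes K$ ($K$ acting on $\mathfrak p$ by $Ad$). Identifying $\mathfrak g^*$ with $\mathfrak g$ through $\langle\ ,\ \rangle$, the Hamiltonian equations of a function $h$ on $\mathfrak g$ relative to $[\ ,\ ]_s$ are $$\Big\langle\frac{dL}{dt},X\Big\rangle=-\langle L,[dh(L),X]_s\rangle\quad\text{for all }X\in\mathfrak g,$$ where $dh(L)\in\mathfrak g$ is the differential of $h$ at $L$ identified via $\langle\ ,\ \rangle$ (so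 $dH(L)=L_{\mathfrak k}+A$). The spectral invariants of $L_\lambda$ are the functions of $L$ given by the coefficients of the characteristic polynomial of $L_\lambda$ (as a matrix in a matrix realization of $\mathfrak g$, or of $ad\,L_\lambda$). *)

theory Defs
  imports
    "HOL-Analysis.Analysis"
    "HOL-Algebra.Group"
    "Jordan_Normal_Form.Char_Poly"
begin

text \<open>
  The Lie algebra of an \<open>n\<close>-dimensional Lie group is carried by a Euclidean space type \<open>'a\<close> with
  \<open>DIM('a) = n\<close>, which is also the model space of the charts. The inner product of \<open>'a\<close> serves only
  to provide the topology of a finite-dimensional real vector space; the invariant form on the Lie
  algebra is a separate parameter.
\<close>

section \<open>Lie groups\<close>

text \<open>For open \<open>S\<close> and finite-dimensional domain this is the usual notion of a \<open>C\<^sup>k\<close> map.\<close>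

primrec Ck_on :: "nat \<Rightarrow> 'a::real_normed_vector set \<Rightarrow> ('a \<Rightarrow> 'b::real_normed_vector) \<Rightarrow> bool" where
  "Ck_on 0 S f \<longleftrightarrow> continuous_on S f"
| "Ck_on (Suc k) S f \<longleftrightarrow>
     f differentiable_on S \<and> (\<forall>v. Ck_on k S (\<lambda>x. frechet_derivative f (at x) v))"

definition smooth_on :: "'a::real_normed_vector set \<Rightarrow> ('a \<Rightarrow> 'b::real_normed_vector) \<Rightarrow> bool" where
  "smooth_on S f \<longleftrightarrow> (\<forall>k. Ck_on k S f)"

type_synonym ('g, 'a) chart = "'g set \<times> ('g \<Rightarrow> 'a)"

definition smooth_atlas :: "'g topology \<Rightarrow> ('g, 'a::euclidean_space) chart set \<Rightarrow> bool" where
  "smooth_atlas T \<A> \<longleftrightarrow>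
     (\<forall>(U, \<phi>)\<in>\<A>. openin T U \<and> open (\<phi> ` U) \<and>
        homeomorphic_map (subtopology T U) (top_of_set (\<phi> ` U)) \<phi>) \<and>
     (\<Union>(U, \<phi>)\<in>\<A>. U) = topspace T \<and>
     (\<forall>(U, \<phi>)\<in>\<A>. \<forall>(V, \<psi>)\<in>\<A>. smooth_on (\<phi> ` (U \<inter> V)) (\<psi> \<circ> inv_into U \<phi>))"

definition smooth_manifold :: "'g topology \<Rightarrow> ('g, 'a::euclidean_space) chart set \<Rightarrow> bool" where
  "smooth_manifold T \<A> \<longleftrightarrow> Hausdorff_space T \<and> second_countable T \<and> smooth_atlas T \<A>"

definition smooth_map ::
  "'g topology \<Rightarrow> ('g, 'a::euclidean_space) chart set \<Rightarrow> ('g \<Rightarrow> 'g) \<Rightarrow> bool" where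
  "smooth_map T \<A> f \<longleftrightarrow> continuous_map T T f \<and>
     (\<forall>(U, \<phi>)\<in>\<A>. \<forall>(V, \<psi>)\<in>\<A>. smooth_on (\<phi> ` {x\<in>U. f x \<in> V}) (\<psi> \<circ> f \<circ> inv_into U \<phi>))"

definition smooth_map2 ::
  "'g topology \<Rightarrow> ('g, 'a::euclidean_space) chart set \<Rightarrow> ('g \<Rightarrow> 'g \<Rightarrow> 'g) \<Rightarrow> bool" where
  "smooth_map2 T \<A> m \<longleftrightarrow> continuous_map (prod_topology T T) T (\<lambda>(x, y). m x y) \<and>
     (\<forall>(U, \<phi>)\<in>\<A>. \<forall>(V, \<psi>)\<in>\<A>. \<forall>(W, \<eta>)\<in>\<A>.
        smooth_on {(\<phi> x, \<psi> y) | x y. x \<in> U \<and> y \<in> V \<and> m x y \<in> W}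
          (\<lambda>(a, b). \<eta> (m (inv_into U \<phi> a) (inv_into V \<psi> b))))"

definition lie_group ::
  "('g, 'm) monoid_scheme \<Rightarrow> 'g topology \<Rightarrow> ('g, 'a::euclidean_space) chart set \<Rightarrow> bool" where
  "lie_group G T \<A> \<longleftrightarrow> group G \<and> topspace T = carrier G \<and> smooth_manifold T \<A> \<and>
     smooth_map2 T \<A> (\<lambda>x y. x \<otimes>\<^bsub>G\<^esub> y) \<and> smooth_map T \<A> (\<lambda>x. inv\<^bsub>G\<^esub> x)"


section \<open>The Lie algebra of a Lie group\<close>

text \<open>
  A chart \<open>(U, \<phi>)\<close> around the identity identifies the tangent space at the identity with \<open>'a\<close>.
  In this chart we write down left-invariant vector fields, their commutator, and the tangent
  map at the identity of a map that fixes the identity.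
\<close>

definition tangent_map ::
  "('g, 'm) monoid_scheme \<Rightarrow> ('g, 'a::euclidean_space) chart \<Rightarrow> ('g \<Rightarrow> 'g) \<Rightarrow> 'a \<Rightarrow> 'a" where
  "tangent_map G c f = (case c of (U, \<phi>) \<Rightarrow>
     frechet_derivative (\<phi> \<circ> f \<circ> inv_into U \<phi>) (at (\<phi> \<one>\<^bsub>G\<^esub>)))"

definition left_invariant_field ::
  "('g, 'm) monoid_scheme \<Rightarrow> ('g, 'a::euclidean_space) chart \<Rightarrow> 'a \<Rightarrow> 'a \<Rightarrow> 'a" where
  "left_invariant_field G c v x = (case c of (U, \<phi>) \<Rightarrow>
     frechet_derivative (\<lambda>y. \<phi> (inv_into U \<phi> x \<otimes>\<^bsub>G\<^esub> inv_into U \<phi> y)) (at (\<phi> \<one>\<^bsub>G\<^esub>)) v)"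

definition vector_field_bracket ::
  "('a::euclidean_space \<Rightarrow> 'a) \<Rightarrow> ('a \<Rightarrow> 'a) \<Rightarrow> 'a \<Rightarrow> 'a" where
  "vector_field_bracket X Y x =
     frechet_derivative Y (at x) (X x) - frechet_derivative X (at x) (Y x)"

definition lie_group_bracket ::
  "('g, 'm) monoid_scheme \<Rightarrow> ('g, 'a::euclidean_space) chart \<Rightarrow> 'a \<Rightarrow> 'a \<Rightarrow> 'a" where
  "lie_group_bracket G c v w =
     vector_field_bracket (left_invariant_field G c v) (left_invariant_field G c w)
       (snd c \<one>\<^bsub>G\<^esub>)"

definition Ad_map ::
  "('g, 'm) monoid_scheme \<Rightarrow> ('g, 'a::euclidean_space) chart \<Rightarrow> 'g \<Rightarrow> 'a \<Rightarrow> 'a" where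
  "Ad_map G c g = tangent_map G c (\<lambda>x. g \<otimes>\<^bsub>G\<^esub> x \<otimes>\<^bsub>G\<^esub> inv\<^bsub>G\<^esub> g)"

definition lie_algebra :: "('a::real_vector \<Rightarrow> 'a \<Rightarrow> 'a) \<Rightarrow> bool" where
  "lie_algebra br \<longleftrightarrow> bilinear br \<and> (\<forall>X. br X X = 0) \<and>
     (\<forall>X Y Z. br X (br Y Z) + br Y (br Z X) + br Z (br X Y) = 0)"

text \<open>The Lie algebra laws follow from the second conjunct when \<open>G\<close> is a Lie group with chart \<open>c\<close>
  around the identity; they are recorded for convenience.\<close>

definition lie_algebra_of ::
  "('g, 'm) monoid_scheme \<Rightarrow> ('g, 'a::euclidean_space) chart \<Rightarrow> ('a \<Rightarrow> 'a \<Rightarrow> 'a) \<Rightarrow> bool" where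
  "lie_algebra_of G c br \<longleftrightarrow> lie_algebra br \<and> (\<forall>X Y. br X Y = lie_group_bracket G c X Y)"

definition trace_map :: "('a::euclidean_space \<Rightarrow> 'a) \<Rightarrow> real" where
  "trace_map f = (\<Sum>b\<in>Basis. f b \<bullet> b)"

definition killing_form :: "('a::euclidean_space \<Rightarrow> 'a \<Rightarrow> 'a) \<Rightarrow> 'a \<Rightarrow> 'a \<Rightarrow> real" where
  "killing_form br X Y = trace_map (\<lambda>Z. br X (br Y Z))"

definition semisimple :: "('a::euclidean_space \<Rightarrow> 'a \<Rightarrow> 'a) \<Rightarrow> bool" where
  "semisimple br \<longleftrightarrow> (\<forall>X. (\<forall>Y. killing_form br X Y = 0) \<longrightarrow> X = 0)"


section \<open>Riemannian symmetric pairs and the Cartan splitting\<close>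

definition involutive_lie_automorphism ::
  "('g, 'm) monoid_scheme \<Rightarrow> 'g topology \<Rightarrow> ('g, 'a::euclidean_space) chart set \<Rightarrow> ('g \<Rightarrow> 'g) \<Rightarrow> bool"
  where
  "involutive_lie_automorphism G T \<A> \<sigma> \<longleftrightarrow>
     \<sigma> \<in> iso G G \<and> smooth_map T \<A> \<sigma> \<and> (\<forall>x\<in>carrier G. \<sigma> (\<sigma> x) = x)"

definition fixed_points :: "('g, 'm) monoid_scheme \<Rightarrow> ('g \<Rightarrow> 'g) \<Rightarrow> 'g set" where
  "fixed_points G \<sigma> = {x\<in>carrier G. \<sigma> x = x}"

text \<open>Helgason's definition: \<open>K\<close> is closed, lies between \<open>Fix \<sigma>\<close> and its identity component, and
  \<open>Ad K\<close> is a compact group of linear maps.\<close>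

definition riemannian_symmetric_pair ::
  "('g, 'm) monoid_scheme \<Rightarrow> 'g topology \<Rightarrow> ('g, 'a::euclidean_space) chart \<Rightarrow> 'g set \<Rightarrow> ('g \<Rightarrow> 'g) \<Rightarrow> bool"
  where
  "riemannian_symmetric_pair G T c K \<sigma> \<longleftrightarrow>
     subgroup K G \<and> closedin T K \<and> K \<subseteq> fixed_points G \<sigma> \<and>
     connected_component_of_set (subtopology T (fixed_points G \<sigma>)) \<one>\<^bsub>G\<^esub> \<subseteq> K \<and>
     compact ((\<lambda>k. Blinfun (Ad_map G c k)) ` K)"

text \<open>In the following \<open>\<theta>\<close> is the tangent map of the involution \<open>\<sigma>\<close> at the identity.\<close>

definition p_subspace :: "('a::real_vector \<Rightarrow> 'a) \<Rightarrow> 'a set" where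
  "p_subspace \<theta> = {X. \<theta> X = - X}"

definition k_subspace :: "('a::real_vector \<Rightarrow> 'a) \<Rightarrow> 'a set" where
  "k_subspace \<theta> = {X. \<theta> X = X}"

definition p_part :: "('a::real_vector \<Rightarrow> 'a) \<Rightarrow> 'a \<Rightarrow> 'a" where
  "p_part \<theta> X = (1/2) *\<^sub>R (X - \<theta> X)"

definition k_part :: "('a::real_vector \<Rightarrow> 'a) \<Rightarrow> 'a \<Rightarrow> 'a" where
  "k_part \<theta> X = (1/2) *\<^sub>R (X + \<theta> X)"

definition bracket_space :: "('a::real_vector \<Rightarrow> 'a \<Rightarrow> 'a) \<Rightarrow> 'a set \<Rightarrow> 'a set \<Rightarrow> 'a set" where
  "bracket_space br V W = span {br X Y | X Y. X \<in> V \<and> Y \<in> W}"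

definition regular_element ::
  "('a::real_vector \<Rightarrow> 'a \<Rightarrow> 'a) \<Rightarrow> ('a \<Rightarrow> 'a) \<Rightarrow> 'a \<Rightarrow> bool" where
  "regular_element br \<theta> A \<longleftrightarrow> A \<in> p_subspace \<theta> \<and>
     (\<forall>B\<in>p_subspace \<theta>. \<forall>C\<in>p_subspace \<theta>. br A B = 0 \<longrightarrow> br A C = 0 \<longrightarrow> br B C = 0)"

definition deformed_bracket ::
  "('a::real_vector \<Rightarrow> 'a \<Rightarrow> 'a) \<Rightarrow> ('a \<Rightarrow> 'a) \<Rightarrow> real \<Rightarrow> 'a \<Rightarrow> 'a \<Rightarrow> 'a" where
  "deformed_bracket br \<theta> s X Y =
     br (k_part \<theta> X) (p_part \<theta> Y) - br (k_part \<theta> Y) (p_part \<theta> X)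
     + br (k_part \<theta> X) (k_part \<theta> Y) + s *\<^sub>R br (p_part \<theta> X) (p_part \<theta> Y)"


section \<open>Hamiltonian systems\<close>

text \<open>In the following \<open>F\<close> is a nondegenerate symmetric bilinear form, and \<open>brs\<close> the Lie bracket
  defining the Poisson structure.\<close>

definition gradient ::
  "('a::euclidean_space \<Rightarrow> 'a \<Rightarrow> real) \<Rightarrow> ('a \<Rightarrow> real) \<Rightarrow> 'a \<Rightarrow> 'a" where
  "gradient F h L = (THE Y. \<forall>X. F Y X = frechet_derivative h (at L) X)"

definition hamiltonian_solution ::
  "('a::euclidean_space \<Rightarrow> 'a \<Rightarrow> real) \<Rightarrow> ('a \<Rightarrow> 'a \<Rightarrow> 'a) \<Rightarrow> ('a \<Rightarrow> real) \<Rightarrow> real set \<Rightarrow> (real \<Rightarrow> 'a) \<Rightarrow> bool"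
  where
  "hamiltonian_solution F brs h I L \<longleftrightarrow> is_interval I \<and>
     (\<forall>t\<in>I. \<exists>V. (L has_vector_derivative V) (at t within I) \<and>
        (\<forall>X. F V X = - F (L t) (brs (gradient F h (L t)) X)))"

definition constant_of_motion ::
  "('a::euclidean_space \<Rightarrow> 'a \<Rightarrow> real) \<Rightarrow> ('a \<Rightarrow> 'a \<Rightarrow> 'a) \<Rightarrow> ('a \<Rightarrow> real) \<Rightarrow> ('a \<Rightarrow> 'b) \<Rightarrow> bool" where
  "constant_of_motion F brs h f \<longleftrightarrow>
     (\<forall>I L. hamiltonian_solution F brs h I L \<longrightarrow> (\<forall>t\<in>I. \<forall>u\<in>I. f (L t) = f (L u)))"

definition affine_hamiltonian ::
  "('a::real_vector \<Rightarrow> 'a \<Rightarrow> real) \<Rightarrow> ('a \<Rightarrow> 'a) \<Rightarrow> 'a \<Rightarrow> 'a \<Rightarrow> real" where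
  "affine_hamiltonian F \<theta> A L = 1/2 * F (k_part \<theta> L) (k_part \<theta> L) + F A (p_part \<theta> L)"

definition Lax_M :: "('a::real_vector \<Rightarrow> 'a) \<Rightarrow> 'a \<Rightarrow> real \<Rightarrow> real \<Rightarrow> 'a \<Rightarrow> 'a" where
  "Lax_M \<theta> A s lam L = (1/lam) *\<^sub>R (p_part \<theta> L - s *\<^sub>R A)"

definition Lax_L :: "('a::real_vector \<Rightarrow> 'a) \<Rightarrow> 'a \<Rightarrow> real \<Rightarrow> real \<Rightarrow> 'a \<Rightarrow> 'a" where
  "Lax_L \<theta> A s lam L = p_part \<theta> L - lam *\<^sub>R k_part \<theta> L + (lam\<^sup>2 - s) *\<^sub>R A"


section \<open>Spectral invariants\<close>

text \<open>The entries may be real or complex, these being the instances of \<open>real_normed_field\<close>.\<close>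

definition matrix_realization ::
  "('a::real_vector \<Rightarrow> 'a \<Rightarrow> 'a) \<Rightarrow> nat \<Rightarrow> ('a \<Rightarrow> 'f::real_normed_field mat) \<Rightarrow> bool" where
  "matrix_realization br n \<rho> \<longleftrightarrow>
     (\<forall>X. \<rho> X \<in> carrier_mat n n) \<and> inj \<rho> \<and>
     (\<forall>X Y. \<rho> (X + Y) = \<rho> X + \<rho> Y) \<and>
     (\<forall>r X. \<rho> (r *\<^sub>R X) = of_real r \<cdot>\<^sub>m \<rho> X) \<and>
     (\<forall>X Y. \<rho> (br X Y) = \<rho> X * \<rho> Y - \<rho> Y * \<rho> X)"

definition ordered_basis :: "'a::real_vector list \<Rightarrow> bool" where
  "ordered_basis bs \<longleftrightarrow> distinct bs \<and> independent (set bs) \<and> span (set bs) = UNIV"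

definition matrix_of_map :: "'a::real_vector list \<Rightarrow> ('a \<Rightarrow> 'a) \<Rightarrow> real mat" where
  "matrix_of_map bs f =
     mat (length bs) (length bs) (\<lambda>(i, j). representation (set bs) (f (bs ! j)) (bs ! i))"

end

theory Submission
  imports Defs
begin

text \<open>
  The bracket relations make \<open>\<theta>\<close> an automorphism of the Lie algebra, so the form is invariant under
  \<open>\<theta>\<close> and \<open>\<pp>\<close>, \<open>\<kk>\<close> are orthogonal. It is nondegenerate because \<open>\<kk> \<noteq> 0\<close> forces the scalar to be
  nonzero. Moving brackets across the invariant form turns the Hamiltonian equations into
  \<open>L\<^sub>p' = [L\<^sub>k, L\<^sub>p - s A]\<close> and \<open>L\<^sub>k' = [A, L\<^sub>p]\<close>, whose combination \<open>L\<^sub>p' - \<lambda> L\<^sub>k'\<close> is \<open>[M\<^sub>\<lambda>, L\<^sub>\<lambda>]\<close>.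

  For a matrix equation \<open>X' = [M, X]\<close> put \<open>N = x 1 - X\<close>, so that \<open>N' = [M, N]\<close>. By Jacobi's formula
  \<open>(det N)' = tr (N' adj N) = tr (M N adj N) - tr (M (adj N) N) = 0\<close>, for every scalar \<open>x\<close>.
\<close>

section \<open>Isospectral matrix equations\<close>

text \<open>Jacobi's formula, with \<open>tr (D adj N)\<close> written out in cofactors. The product
  rule is applied to each term of the Leibniz expansion; collecting the terms by the row that was
  differentiated gives one determinant per row.\<close>

lemma has_vector_derivative_det:
  fixes N :: "real \<Rightarrow> 'f::real_normed_field mat"
  assumes N: "\<And>t. N t \<in> carrier_mat n n" and D: "D \<in> carrier_mat n n"
    and der: "\<And>i j. i < n \<Longrightarrow> j < n \<Longrightarrow>
      ((\<lambda>u. N u $$ (i, j)) has_vector_derivative D $$ (i, j)) (at t within I)"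
  shows "((\<lambda>u. Determinant.det (N u)) has_vector_derivative
      (\<Sum>i<n. \<Sum>j<n. D $$ (i, j) * cofactor (N t) i j)) (at t within I)"
proof -
  let ?P = "{p. p permutes {0..<n}}"
  \<comment> \<open>\<open>N t\<close> with row \<open>i\<close> replaced by that of \<open>D\<close>: the derivative is the sum of the determinants of
    these matrices, each expanded along row \<open>i\<close>.\<close>
  define R where "R i = mat n n (\<lambda>(k, j). if k = i then D $$ (i, j) else N t $$ (k, j))" for i
  have R: "R i \<in> carrier_mat n n" for i
    by (simp add: R_def)
  have perm: "p i < n" if "p \<in> ?P" "i < n" for p i
    using that permutes_in_image[of p "{0..<n}" i] by simp
  have row: "Determinant.det (R i) = (\<Sum>j<n. D $$ (i, j) * cofactor (N t) i j)" if "i < n" for i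
  proof -
    \<comment> \<open>Row \<open>i\<close> is the only place where \<open>R i\<close> and
      \<open>N t\<close> differ, so deleting it makes the cofactors along that row agree.\<close>
    have "mat_delete (R i) i j = mat_delete (N t) i j" for j
      using N[of t] that by (intro eq_matI) (auto simp: R_def mat_delete_def)
    then show ?thesis
      unfolding laplace_expansion_row[OF R that]
      using that by (intro sum.cong) (auto simp: R_def cofactor_def)
  qed
  have rowprod: "(\<Prod>k = 0..<n. R i $$ (k, p k)) = D $$ (i, p i) * (\<Prod>k\<in>{0..<n} - {i}. N t $$ (k, p k))"
    if "p \<in> ?P" "i < n" for p i
  proof -
    have "(\<Prod>k = 0..<n. R i $$ (k, p k)) = R i $$ (i, p i) * (\<Prod>k\<in>{0..<n} - {i}. R i $$ (k, p k))"
      using that by (intro prod.remove) auto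
    also have "(\<Prod>k\<in>{0..<n} - {i}. R i $$ (k, p k)) = (\<Prod>k\<in>{0..<n} - {i}. N t $$ (k, p k))"
      using perm[OF that(1)] by (intro prod.cong) (auto simp: R_def)
    also have "R i $$ (i, p i) = D $$ (i, p i)"
      using perm[OF that] that(2) by (simp add: R_def)
    finally show ?thesis .
  qed
  have "((\<lambda>u. \<Prod>i = 0..<n. N u $$ (i, p i)) has_vector_derivative
      (\<Sum>i = 0..<n. \<Prod>k = 0..<n. R i $$ (k, p k))) (at t within I)" if p: "p \<in> ?P" for p
  proof -
    have "((\<lambda>u. \<Prod>i = 0..<n. N u $$ (i, p i)) has_derivative
        (\<lambda>y. \<Sum>i = 0..<n. (y *\<^sub>R D $$ (i, p i)) * (\<Prod>k\<in>{0..<n} - {i}. N t $$ (k, p k))))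
        (at t within I)"
      by (rule has_derivative_prod)
        (use der perm[OF p] in \<open>auto simp: has_vector_derivative_def\<close>)
    also have "(\<lambda>y. \<Sum>i = 0..<n. (y *\<^sub>R D $$ (i, p i)) * (\<Prod>k\<in>{0..<n} - {i}. N t $$ (k, p k)))
        = (\<lambda>y. y *\<^sub>R (\<Sum>i = 0..<n. \<Prod>k = 0..<n. R i $$ (k, p k)))"
      by (auto simp: scaleR_sum_right rowprod[OF p] intro!: ext sum.cong)
    finally show ?thesis
      by (simp add: has_vector_derivative_def)
  qed
  then have "((\<lambda>u. \<Sum>p\<in>?P. signof p * (\<Prod>i = 0..<n. N u $$ (i, p i))) has_vector_derivative
      (\<Sum>p\<in>?P. signof p * (\<Sum>i = 0..<n. \<Prod>k = 0..<n. R i $$ (k, p k)))) (at t within I)"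
    by (intro has_vector_derivative_sum has_vector_derivative_mult_right)
  also have "(\<Sum>p\<in>?P. signof p * (\<Sum>i = 0..<n. \<Prod>k = 0..<n. R i $$ (k, p k)))
      = (\<Sum>i = 0..<n. Determinant.det (R i))"
    unfolding det_def'[OF R] sum_distrib_left by (rule sum.swap)
  also have "\<dots> = (\<Sum>i<n. \<Sum>j<n. D $$ (i, j) * cofactor (N t) i j)"
    by (auto simp: atLeast0LessThan row intro!: sum.cong)
  finally show ?thesis
    by (simp add: det_def'[OF N])
qed

lemma sum_mult_comm_mat:
  fixes X Y :: "'f::comm_ring_1 mat"
  assumes "X \<in> carrier_mat n n" "Y \<in> carrier_mat n n"
  shows "(\<Sum>i<n. (X * Y) $$ (i, i)) = (\<Sum>i<n. (Y * X) $$ (i, i))"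
proof -
  have "(\<Sum>i<n. (X * Y) $$ (i, i)) = (\<Sum>i<n. \<Sum>k<n. X $$ (i, k) * Y $$ (k, i))"
    using assms by (auto simp: scalar_prod_def atLeast0LessThan intro!: sum.cong)
  also have "\<dots> = (\<Sum>k<n. \<Sum>i<n. Y $$ (k, i) * X $$ (i, k))"
    by (subst sum.swap) (simp add: mult.commute)
  also have "\<dots> = (\<Sum>i<n. (Y * X) $$ (i, i))"
    using assms by (auto simp: scalar_prod_def atLeast0LessThan intro!: sum.cong)
  finally show ?thesis .
qed

text \<open>The adjugate is the transposed cofactor matrix, so the sum is the trace of
  \<open>(M N - N M) adj N\<close>. Both \<open>N adj N\<close> and \<open>(adj N) N\<close> equal
  \<open>det N\<close> times the identity, also for singular \<open>N\<close>, and cyclicity of the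
  trace makes the two halves cancel.\<close>

lemma sum_commutator_cofactor:
  fixes M N :: "'f::comm_ring_1 mat"
  assumes M: "M \<in> carrier_mat n n" and N: "N \<in> carrier_mat n n"
  shows "(\<Sum>i<n. \<Sum>j<n. (M * N - N * M) $$ (i, j) * cofactor N i j) = 0"
proof -
  let ?A = "adj_mat N"
  note A = adj_mat[OF N]
  note carrier = M N A(1) mult_carrier_mat[OF M N] mult_carrier_mat[OF N M]
  have "(\<Sum>i<n. \<Sum>j<n. (M * N - N * M) $$ (i, j) * cofactor N i j)
      = (\<Sum>i<n. ((M * N - N * M) * ?A) $$ (i, i))"
    using carrier
    by (auto simp: scalar_prod_def adj_mat_def atLeast0LessThan intro!: sum.cong)
  also have "\<dots> = (\<Sum>i<n. (M * (N * ?A) - N * (M * ?A)) $$ (i, i))"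
    using carrier by (simp add: minus_mult_distrib_mat[of _ n n])
  also have "\<dots> = (\<Sum>i<n. (M * (N * ?A)) $$ (i, i)) - (\<Sum>i<n. (N * (M * ?A)) $$ (i, i))"
    using carrier by (simp add: sum_subtractf[symmetric])
  also have "(\<Sum>i<n. (N * (M * ?A)) $$ (i, i)) = (\<Sum>i<n. (M * (?A * N)) $$ (i, i))"
    using sum_mult_comm_mat[of N n "M * ?A"] carrier by simp
  finally show ?thesis
    unfolding A by simp
qed

text \<open>The value of the characteristic polynomial at each fixed scalar has derivative zero, and
  polynomials over an infinite field are determined by their values. This avoids conjugating by a
  solution of \<open>g' = M g\<close>, so \<open>M\<close> may depend on \<open>t\<close> in any
  way.\<close>

lemma char_poly_constant_of_commutator_derivative:
  fixes X :: "real \<Rightarrow> 'f::real_normed_field mat"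
  assumes I: "is_interval I"
    and X: "\<And>t. X t \<in> carrier_mat n n" and M: "\<And>t. M t \<in> carrier_mat n n"
    and der: "\<And>t i j. t \<in> I \<Longrightarrow> i < n \<Longrightarrow> j < n \<Longrightarrow>
      ((\<lambda>u. X u $$ (i, j)) has_vector_derivative (M t * X t - X t * M t) $$ (i, j)) (at t within I)"
    and "t \<in> I" "u \<in> I"
  shows "char_poly (X t) = char_poly (X u)"
proof -
  have "poly (char_poly (X t)) x = poly (char_poly (X u)) x" for x
  proof -
    \<comment> \<open>This is \<open>x 1 - X v\<close>, in the form in which
      \<open>char_poly_matrix\<close> expresses the value at \<open>x\<close> as a
      determinant.\<close>
    define N where "N v = - char_matrix (X v) x" for v
    have N: "N v \<in> carrier_mat n n" for v
      using X by (simp add: N_def)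
    have N_eq: "N v = x \<cdot>\<^sub>m 1\<^sub>m n - X v" for v
      using X[of v] by (intro eq_matI) (auto simp: N_def char_matrix_def)
    \<comment> \<open>The scalar part commutes with \<open>M v\<close>, and the sign matches
      \<open>N' = - X'\<close>; hence \<open>N\<close> obeys the same commutator equation as
      \<open>X\<close>.\<close>
    have comm: "M v * N v - N v * M v = - (M v * X v - X v * M v)" for v
    proof -
      have "M v * N v = x \<cdot>\<^sub>m M v - M v * X v" "N v * M v = x \<cdot>\<^sub>m M v - X v * M v"
        unfolding N_eq using X[of v] M[of v]
        by (simp_all add: minus_mult_distrib_mat[of _ n n] mult_minus_distrib_mat[of _ n n _ n]
            mult_smult_distrib[of _ n n _ n] mult_smult_assoc_mat[of _ n n _ n])
      then show ?thesis
        using X[of v] M[of v] by (intro eq_matI) auto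
    qed
    have "((\<lambda>u. Determinant.det (N u)) has_vector_derivative 0) (at v within I)" if "v \<in> I" for v
    proof -
      have "((\<lambda>u. N u $$ (i, j)) has_vector_derivative (M v * N v - N v * M v) $$ (i, j))
          (at v within I)" if ij: "i < n" "j < n" for i j
      proof -
        have "((\<lambda>u. x * 1\<^sub>m n $$ (i, j) - X u $$ (i, j)) has_vector_derivative
            0 - (M v * X v - X v * M v) $$ (i, j)) (at v within I)"
          by (intro has_vector_derivative_diff has_vector_derivative_const der ij \<open>v \<in> I\<close>)
        moreover have "N u $$ (i, j) = x * 1\<^sub>m n $$ (i, j) - X u $$ (i, j)" for u
          using X[of u] ij by (simp add: N_eq)
        moreover have "(M v * N v - N v * M v) $$ (i, j) = 0 - (M v * X v - X v * M v) $$ (i, j)"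
          using X[of v] M[of v] ij by (simp add: comm)
        ultimately show ?thesis by simp
      qed
      then have "((\<lambda>u. Determinant.det (N u)) has_vector_derivative
          (\<Sum>i<n. \<Sum>j<n. (M v * N v - N v * M v) $$ (i, j) * cofactor (N v) i j)) (at v within I)"
        by (intro has_vector_derivative_det) (use N M[of v] in \<open>auto intro!: minus_carrier_mat mult_carrier_mat\<close>)
      then show ?thesis
        using sum_commutator_cofactor[OF M N] by simp
    qed
    then have "Determinant.det (N t) = Determinant.det (N u)"
      using has_vector_derivative_zero_constant[of I "\<lambda>u. Determinant.det (N u)"]
        is_interval_convex[OF I] \<open>t \<in> I\<close> \<open>u \<in> I\<close> by metis
    then show ?thesis
      using X by (simp add: char_poly_matrix[OF X] N_def)
  qed
  then show ?thesis
    by (simp add: poly_eq_poly_eq_iff[symmetric] fun_eq_iff)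
qed

text \<open>Each entry of \<open>\<rho>\<close> is a real linear functional on a finite-dimensional
  space, hence bounded, so the bracket equation passes entrywise to matrices. The statement is for
  any representation, to serve both a \<open>matrix_realization\<close> and the adjoint
  representation.\<close>

lemma char_poly_constant_of_Lax_equation:
  fixes \<rho> :: "'a::euclidean_space \<Rightarrow> 'f::real_normed_field mat"
  assumes I: "is_interval I"
    and \<rho>: "\<And>X. \<rho> X \<in> carrier_mat n n"
    and add: "\<And>X Y. \<rho> (X + Y) = \<rho> X + \<rho> Y"
    and scale: "\<And>r X. \<rho> (r *\<^sub>R X) = of_real r \<cdot>\<^sub>m \<rho> X"
    and comm: "\<And>X Y. \<rho> (br X Y) = \<rho> X * \<rho> Y - \<rho> Y * \<rho> X"
    and der: "\<And>t. t \<in> I \<Longrightarrow> (L has_vector_derivative br (M t) (L t)) (at t within I)"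
    and "t \<in> I" "u \<in> I"
  shows "char_poly (\<rho> (L t)) = char_poly (\<rho> (L u))"
proof (rule char_poly_constant_of_commutator_derivative[OF I, of _ n "\<lambda>t. \<rho> (M t)"])
  fix t i j assume t: "t \<in> I" and ij: "i < n" "j < n"
  have "linear (\<lambda>X. \<rho> X $$ (i, j))"
    using ij carrier_matD[OF \<rho>] by (intro linearI) (simp_all add: add scale scaleR_conv_of_real)
  then have "bounded_linear (\<lambda>X. \<rho> X $$ (i, j))"
    by (simp add: linear_conv_bounded_linear)
  from bounded_linear.has_vector_derivative[OF this der[OF t]]
  show "((\<lambda>u. \<rho> (L u) $$ (i, j)) has_vector_derivative
      (\<rho> (M t) * \<rho> (L t) - \<rho> (L t) * \<rho> (M t)) $$ (i, j)) (at t within I)"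
    by (simp add: comm)
qed (use assms in auto)

section \<open>Matrices of linear maps\<close>

lemma linear_representation_coordinate:
  assumes "independent B" "span B = UNIV"
  shows "linear (\<lambda>v. representation B v b)"
  by (rule linearI) (simp_all add: assms representation_add representation_scale)

lemma matrix_of_map_carrier [simp]: "matrix_of_map bs f \<in> carrier_mat (length bs) (length bs)"
  by (simp add: matrix_of_map_def)

lemma matrix_of_map_add:
  assumes "ordered_basis bs"
  shows "matrix_of_map bs (\<lambda>x. f x + g x) = matrix_of_map bs f + matrix_of_map bs g"
  using assms
  by (intro eq_matI) (auto simp: matrix_of_map_def ordered_basis_def representation_add)

lemma matrix_of_map_diff:
  assumes "ordered_basis bs"
  shows "matrix_of_map bs (\<lambda>x. f x - g x) = matrix_of_map bs f - matrix_of_map bs g"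
  using assms
  by (intro eq_matI) (auto simp: matrix_of_map_def ordered_basis_def representation_diff)

lemma matrix_of_map_scaleR:
  assumes "ordered_basis bs"
  shows "matrix_of_map bs (\<lambda>x. r *\<^sub>R f x) = r \<cdot>\<^sub>m matrix_of_map bs f"
  using assms
  by (intro eq_matI) (auto simp: matrix_of_map_def ordered_basis_def representation_scale)

lemma matrix_of_map_compose:
  assumes bs: "ordered_basis bs" and f: "linear f"
  shows "matrix_of_map bs (\<lambda>x. f (g x)) = matrix_of_map bs f * matrix_of_map bs g"
proof (rule eq_matI)
  fix i j assume "i < dim_row (matrix_of_map bs f * matrix_of_map bs g)"
    and "j < dim_col (matrix_of_map bs f * matrix_of_map bs g)"
  then have i: "i < length bs" and j: "j < length bs"
    by (auto simp: matrix_of_map_def)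
  have B: "distinct bs" "independent (set bs)" "span (set bs) = UNIV"
    using bs by (auto simp: ordered_basis_def)
  let ?c = "representation (set bs)"
  have lin: "linear (\<lambda>v. ?c (f v) (bs ! i))"
    using linear_compose[OF f linear_representation_coordinate[OF B(2,3)]] by (simp add: o_def)
  have "g (bs ! j) = (\<Sum>b\<in>set bs. ?c (g (bs ! j)) b *\<^sub>R b)"
    using B by (simp add: sum_representation_eq)
  then have "?c (f (g (bs ! j))) (bs ! i) = ?c (f (\<Sum>b\<in>set bs. ?c (g (bs ! j)) b *\<^sub>R b)) (bs ! i)"
    by simp
  also have "\<dots> = (\<Sum>b\<in>set bs. ?c (f b) (bs ! i) * ?c (g (bs ! j)) b)"
    by (simp add: linear_sum[OF lin] linear_scale[OF lin] mult.commute)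
  also have "\<dots> = (\<Sum>k<length bs. ?c (f (bs ! k)) (bs ! i) * ?c (g (bs ! j)) (bs ! k))"
    using bij_betw_nth[OF B(1) refl refl] by (intro sum.reindex_bij_betw[symmetric])
  finally show "matrix_of_map bs (\<lambda>x. f (g x)) $$ (i, j)
      = (matrix_of_map bs f * matrix_of_map bs g) $$ (i, j)"
    using i j by (simp add: matrix_of_map_def scalar_prod_def atLeast0LessThan)
qed (auto simp: matrix_of_map_def)

section \<open>The Killing form\<close>

text \<open>Cyclicity of the trace, computed in the orthonormal \<open>Basis\<close>. With a
  composite as one of the maps it yields the symmetry, the invariance and the
  \<open>\<theta>\<close>-invariance of the Killing form.\<close>

lemma trace_map_commute:
  fixes f g :: "'a::euclidean_space \<Rightarrow> 'a"
  assumes "linear f" "linear g"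
  shows "trace_map (\<lambda>x. f (g x)) = trace_map (\<lambda>x. g (f x))"
proof -
  have *: "inner (f (g b)) b = (\<Sum>d\<in>Basis. inner (g b) d * inner (f d) b)"
    if "linear f" for f g :: "'a \<Rightarrow> 'a" and b
  proof -
    have "f (g b) = f (\<Sum>d\<in>Basis. inner (g b) d *\<^sub>R d)"
      by (simp add: euclidean_representation)
    then show ?thesis
      using that by (simp add: linear_sum linear_scale inner_sum_left)
  qed
  have "trace_map (\<lambda>x. f (g x)) = (\<Sum>b\<in>Basis. \<Sum>d\<in>Basis. inner (g b) d * inner (f d) b)"
    using assms by (simp add: trace_map_def *)
  also have "\<dots> = (\<Sum>d\<in>Basis. \<Sum>b\<in>Basis. inner (f d) b * inner (g b) d)"
    by (subst sum.swap) (simp add: mult.commute)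
  also have "\<dots> = trace_map (\<lambda>x. g (f x))"
    using assms by (simp add: trace_map_def *)
  finally show ?thesis .
qed

lemma trace_map_diff: "trace_map (\<lambda>x. f x - g x) = trace_map f - trace_map g"
  by (simp add: trace_map_def inner_diff_left sum_subtractf)

lemma trace_map_add: "trace_map (\<lambda>x. f x + g x) = trace_map f + trace_map g"
  by (simp add: trace_map_def inner_add_left sum.distrib)

lemma trace_map_scaleR: "trace_map (\<lambda>x. r *\<^sub>R f x) = r * trace_map f"
  by (simp add: trace_map_def sum_distrib_left)

locale lie_bracket =
  fixes br :: "'a::euclidean_space \<Rightarrow> 'a \<Rightarrow> 'a"
  assumes lie_algebra: "lie_algebra br"
begin

lemma bilinear_br: "bilinear br"
  using lie_algebra by (simp add: lie_algebra_def)

lemma linear_br [intro]: "linear (br X)"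
  using bilinear_br by (simp add: bilinear_def)

lemmas br_simps [simp] =
  bilinear_ladd[OF bilinear_br] bilinear_radd[OF bilinear_br]
  bilinear_lsub[OF bilinear_br] bilinear_rsub[OF bilinear_br]
  bilinear_lneg[OF bilinear_br] bilinear_rneg[OF bilinear_br]
  bilinear_lmul[OF bilinear_br] bilinear_rmul[OF bilinear_br]
  bilinear_lzero[OF bilinear_br] bilinear_rzero[OF bilinear_br]

lemma br_self [simp]: "br X X = 0"
  using lie_algebra by (simp add: lie_algebra_def)

lemma br_swap: "br X Y = - br Y X"
proof -
  have "br (X + Y) (X + Y) = br X Y + br Y X"
    unfolding bilinear_ladd[OF bilinear_br] bilinear_radd[OF bilinear_br] by simp
  then show ?thesis by (simp add: eq_neg_iff_add_eq_0 del: br_simps)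
qed

text \<open>The Jacobi identity in the form that says that \<open>ad\<close> is a
  representation.\<close>

lemma br_br: "br (br X Y) Z = br X (br Y Z) - br Y (br X Z)"
proof -
  have "br X (br Y Z) + br Y (br Z X) + br Z (br X Y) = 0"
    using lie_algebra by (simp add: lie_algebra_def)
  then show ?thesis
    using br_swap[of Z X] br_swap[of Z "br X Y"] by (simp add: algebra_simps)
qed

lemma br_add: "br (X + Y) = (\<lambda>Z. br X Z + br Y Z)"
  by (simp add: fun_eq_iff)

lemma br_scaleR: "br (r *\<^sub>R X) = (\<lambda>Z. r *\<^sub>R br X Z)"
  by (simp add: fun_eq_iff)

lemma br_commutator: "br (br X Y) = (\<lambda>Z. br X (br Y Z) - br Y (br X Z))"
  by (simp add: fun_eq_iff br_br)

lemma linear_br_br: "linear (\<lambda>Z. br X (br Y Z))"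
  using linear_compose[OF linear_br linear_br] by (simp add: o_def)

lemma killing_form_sym: "killing_form br X Y = killing_form br Y X"
  unfolding killing_form_def by (rule trace_map_commute) auto

text \<open>Once \<open>ad\<close> of the brackets is expanded, both sides contain
  \<open>tr (ad X ad Y ad Z)\<close>; the other terms \<open>tr (ad Y ad X ad Z)\<close> and
  \<open>tr (ad X ad Z ad Y)\<close> differ by a cyclic shift.\<close>

lemma killing_form_invariant: "killing_form br (br X Y) Z = killing_form br X (br Y Z)"
proof -
  have "trace_map (\<lambda>W. br Y (br X (br Z W))) = trace_map (\<lambda>W. br X (br Z (br Y W)))"
    by (rule trace_map_commute[OF linear_br linear_br_br])
  then show ?thesis
    by (simp add: killing_form_def br_br trace_map_diff)
qed

lemma bilinear_killing_form: "bilinear (killing_form br)"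
proof -
  have "linear (killing_form br X)" for X
    by (rule linearI) (simp_all add: killing_form_def trace_map_add trace_map_scaleR)
  moreover have "linear (\<lambda>X. killing_form br X Y)" for Y
    by (rule linearI) (simp_all add: killing_form_def trace_map_add trace_map_scaleR)
  ultimately show ?thesis
    by (simp add: bilinear_def)
qed

lemma char_poly_adjoint_constant:
  assumes bs: "ordered_basis bs" and I: "is_interval I"
    and der: "\<And>t. t \<in> I \<Longrightarrow> (L has_vector_derivative br (M t) (L t)) (at t within I)"
    and "t \<in> I" "u \<in> I"
  shows "char_poly (matrix_of_map bs (br (L t))) = char_poly (matrix_of_map bs (br (L u)))"
proof (rule char_poly_constant_of_Lax_equation
      [where \<rho> = "\<lambda>X. matrix_of_map bs (br X)" and br = br, OF I matrix_of_map_carrier _ _ _ der \<open>t \<in> I\<close> \<open>u \<in> I\<close>])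
  show "matrix_of_map bs (br (X + Y)) = matrix_of_map bs (br X) + matrix_of_map bs (br Y)" for X Y
    using matrix_of_map_add[OF bs, of "br X" "br Y"] by (simp add: br_add)
  show "matrix_of_map bs (br (r *\<^sub>R X)) = of_real r \<cdot>\<^sub>m matrix_of_map bs (br X)" for r X
    using matrix_of_map_scaleR[OF bs, of r "br X"] by (simp add: br_scaleR)
  show "matrix_of_map bs (br (br X Y)) = matrix_of_map bs (br X) * matrix_of_map bs (br Y)
      - matrix_of_map bs (br Y) * matrix_of_map bs (br X)" for X Y
    using matrix_of_map_diff[OF bs, of "\<lambda>Z. br X (br Y Z)" "\<lambda>Z. br Y (br X Z)"]
      matrix_of_map_compose[OF bs linear_br[of X], of "br Y"]
      matrix_of_map_compose[OF bs linear_br[of Y], of "br X"]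
    by (simp add: br_commutator)
qed

end

section \<open>Symmetric Lie algebras\<close>

text \<open>The infinitesimal data of the symmetric pair. That \<open>\<theta>\<close> respects
  brackets is derived from the bracket relations in \<open>theta_br\<close>, so the homomorphism
  property of \<open>\<sigma>\<close> never has to be differentiated.\<close>

locale symmetric_lie_algebra = lie_bracket br
  for br :: "'a::euclidean_space \<Rightarrow> 'a \<Rightarrow> 'a" +
  fixes \<theta> :: "'a \<Rightarrow> 'a"
  assumes linear_theta: "linear \<theta>"
    and theta_theta [simp]: "\<theta> (\<theta> X) = X"
    and br_pp: "X \<in> p_subspace \<theta> \<Longrightarrow> Y \<in> p_subspace \<theta> \<Longrightarrow> br X Y \<in> k_subspace \<theta>"
    and br_pk: "X \<in> p_subspace \<theta> \<Longrightarrow> Y \<in> k_subspace \<theta> \<Longrightarrow> br X Y \<in> p_subspace \<theta>"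
    and br_kk: "X \<in> k_subspace \<theta> \<Longrightarrow> Y \<in> k_subspace \<theta> \<Longrightarrow> br X Y \<in> k_subspace \<theta>"
begin

lemmas theta_simps [simp] =
  linear_add[OF linear_theta] linear_diff[OF linear_theta] linear_neg[OF linear_theta]
  linear_scale[OF linear_theta] linear_0[OF linear_theta]

lemma br_kp: "X \<in> k_subspace \<theta> \<Longrightarrow> Y \<in> p_subspace \<theta> \<Longrightarrow> br X Y \<in> p_subspace \<theta>"
  using br_pk[of Y X] br_swap[of X Y] by (simp add: p_subspace_def)

lemma p_part_in [simp]: "p_part \<theta> X \<in> p_subspace \<theta>"
  by (simp add: p_part_def p_subspace_def algebra_simps)

lemma k_part_in [simp]: "k_part \<theta> X \<in> k_subspace \<theta>"
  by (simp add: k_part_def k_subspace_def algebra_simps)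

lemma parts: "X = p_part \<theta> X + k_part \<theta> X"
  by (simp add: p_part_def k_part_def scaleR_right_distrib[symmetric] scaleR_2[symmetric])

lemma theta_p_part [simp]: "\<theta> (p_part \<theta> X) = - p_part \<theta> X"
  using p_part_in[of X] by (simp only: p_subspace_def mem_Collect_eq)

lemma theta_k_part [simp]: "\<theta> (k_part \<theta> X) = k_part \<theta> X"
  using k_part_in[of X] by (simp only: k_subspace_def mem_Collect_eq)

lemma part_of_p [simp]:
  assumes "X \<in> p_subspace \<theta>"
  shows "p_part \<theta> X = X" "k_part \<theta> X = 0"
  using assms by (simp_all add: p_subspace_def p_part_def k_part_def scaleR_2[symmetric])

lemma part_of_k [simp]:
  assumes "X \<in> k_subspace \<theta>"
  shows "p_part \<theta> X = 0" "k_part \<theta> X = X"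
  using assms by (simp_all add: k_subspace_def p_part_def k_part_def scaleR_2[symmetric])

lemma linear_p_part: "linear (p_part \<theta>)"
  by (rule linearI) (simp_all add: p_part_def algebra_simps)

lemma linear_k_part: "linear (k_part \<theta>)"
  by (rule linearI) (simp_all add: k_part_def algebra_simps)

lemmas part_simps [simp] =
  linear_add[OF linear_p_part] linear_diff[OF linear_p_part] linear_scale[OF linear_p_part]
  linear_add[OF linear_k_part] linear_diff[OF linear_k_part] linear_scale[OF linear_k_part]

text \<open>By bilinearity both arguments may be split into their parts. On the four resulting
  brackets the bracket relations say that the signs of \<open>\<theta>\<close> multiply.\<close>

lemma theta_br: "\<theta> (br X Y) = br (\<theta> X) (\<theta> Y)"
proof -
  have *: "\<theta> (br (p_part \<theta> X) (p_part \<theta> Y)) = br (p_part \<theta> X) (p_part \<theta> Y)"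
    "\<theta> (br (p_part \<theta> X) (k_part \<theta> Y)) = - br (p_part \<theta> X) (k_part \<theta> Y)"
    "\<theta> (br (k_part \<theta> X) (p_part \<theta> Y)) = - br (k_part \<theta> X) (p_part \<theta> Y)"
    "\<theta> (br (k_part \<theta> X) (k_part \<theta> Y)) = br (k_part \<theta> X) (k_part \<theta> Y)"
    using br_pp[OF p_part_in p_part_in] br_pk[OF p_part_in k_part_in]
      br_kp[OF k_part_in p_part_in] br_kk[OF k_part_in k_part_in]
    by (auto simp: p_subspace_def k_subspace_def)
  show ?thesis
    by (subst (1 2) parts[of X], subst (1 2) parts[of Y]) (simp add: *)
qed

text \<open>\<open>ad (\<theta> X)\<close> is the conjugate of \<open>ad X\<close> by the involution
  \<open>\<theta>\<close>, and conjugation preserves traces.\<close>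

lemma killing_form_theta: "killing_form br (\<theta> X) (\<theta> Y) = killing_form br X Y"
proof -
  have "br (\<theta> X) (br (\<theta> Y) Z) = \<theta> (br X (br Y (\<theta> Z)))" for Z
    by (simp add: theta_br)
  then have "killing_form br (\<theta> X) (\<theta> Y) = trace_map (\<lambda>Z. \<theta> (br X (br Y (\<theta> Z))))"
    by (simp add: killing_form_def)
  also have "\<dots> = trace_map (\<lambda>Z. br X (br Y (\<theta> (\<theta> Z))))"
    using linear_compose[OF linear_theta linear_br_br[of X Y]]
    by (intro trace_map_commute[OF linear_theta]) (simp add: o_def)
  finally show ?thesis
    by (simp add: killing_form_def)
qed

end

section \<open>Hamiltonian and Lax equations relative to an invariant nondegenerate form\<close>

locale symmetric_lie_algebra_form = symmetric_lie_algebra br \<theta>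
  for br :: "'a::euclidean_space \<Rightarrow> 'a \<Rightarrow> 'a" and \<theta> +
  fixes F :: "'a \<Rightarrow> 'a \<Rightarrow> real"
  assumes bilinear_form: "bilinear F"
    and form_sym: "F X Y = F Y X"
    and form_invariant: "F (br X Y) Z = F X (br Y Z)"
    and form_theta: "F (\<theta> X) (\<theta> Y) = F X Y"
    and form_nondegenerate: "(\<And>Y. F X Y = 0) \<Longrightarrow> X = 0"
begin

lemmas form_simps [simp] =
  bilinear_ladd[OF bilinear_form] bilinear_radd[OF bilinear_form]
  bilinear_lsub[OF bilinear_form] bilinear_rsub[OF bilinear_form]
  bilinear_lneg[OF bilinear_form] bilinear_rneg[OF bilinear_form]
  bilinear_lmul[OF bilinear_form] bilinear_rmul[OF bilinear_form]
  bilinear_lzero[OF bilinear_form] bilinear_rzero[OF bilinear_form]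

lemma form_eqI: "(\<And>Y. F X Y = F X' Y) \<Longrightarrow> X = X'"
  using form_nondegenerate[of "X - X'"] by simp

text \<open>Applying \<open>\<theta>\<close> to both arguments preserves \<open>F X Y\<close> and
  also reverses its sign.\<close>

lemma form_pk:
  assumes "X \<in> p_subspace \<theta>" "Y \<in> k_subspace \<theta>"
  shows "F X Y = 0" "F Y X = 0"
proof -
  show "F X Y = 0"
    using form_theta[of X Y] assms by (simp add: p_subspace_def k_subspace_def)
  then show "F Y X = 0"
    by (simp add: form_sym)
qed

lemma form_p_left: "X \<in> p_subspace \<theta> \<Longrightarrow> F X Y = F X (p_part \<theta> Y)"
  by (subst parts[of Y]) (simp add: form_pk)

lemma form_k_left: "X \<in> k_subspace \<theta> \<Longrightarrow> F X Y = F X (k_part \<theta> Y)"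
  by (subst parts[of Y]) (simp add: form_pk)

lemma form_p_right: "Y \<in> p_subspace \<theta> \<Longrightarrow> F X Y = F (p_part \<theta> X) Y"
  using form_p_left form_sym by metis

lemma form_k_right: "Y \<in> k_subspace \<theta> \<Longrightarrow> F X Y = F (k_part \<theta> X) Y"
  using form_k_left form_sym by metis

text \<open>By symmetry of \<open>F\<close> the two product rule terms of the quadratic part agree
  and absorb the factor one half; orthogonality then removes the projections of \<open>X\<close>.
  Nondegeneracy gives the uniqueness demanded by the description in \<open>gradient\<close>.\<close>

lemma gradient_affine_hamiltonian:
  assumes A: "A \<in> p_subspace \<theta>"
  shows "gradient F (affine_hamiltonian F \<theta> A) L = k_part \<theta> L + A"
proof -
  have F: "bounded_bilinear F"
    using bilinear_form by (simp add: bilinear_conv_bounded_bilinear)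
  have p: "(p_part \<theta> has_derivative p_part \<theta>) (at L)"
    by (simp add: linear_p_part linear_imp_has_derivative)
  have k: "(k_part \<theta> has_derivative k_part \<theta>) (at L)"
    by (simp add: linear_k_part linear_imp_has_derivative)
  \<comment> \<open>The summand \<open>F 0 (p_part \<theta> L)\<close> comes from the product rule
    for \<open>F\<close>, whose first argument \<open>A\<close> is constant.\<close>
  have "(affine_hamiltonian F \<theta> A has_derivative (\<lambda>X. 1/2 * (F (k_part \<theta> L) (k_part \<theta> X)
      + F (k_part \<theta> X) (k_part \<theta> L)) + (F A (p_part \<theta> X) + F 0 (p_part \<theta> L)))) (at L)"
    unfolding affine_hamiltonian_def[abs_def]
    by (intro has_derivative_add has_derivative_mult_right bounded_bilinear.FDERIV[OF F]
        has_derivative_const p k)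
  also have "(\<lambda>X. 1/2 * (F (k_part \<theta> L) (k_part \<theta> X) + F (k_part \<theta> X) (k_part \<theta> L))
      + (F A (p_part \<theta> X) + F 0 (p_part \<theta> L))) = F (k_part \<theta> L + A)"
  proof
    fix X
    show "1/2 * (F (k_part \<theta> L) (k_part \<theta> X) + F (k_part \<theta> X) (k_part \<theta> L))
        + (F A (p_part \<theta> X) + F 0 (p_part \<theta> L)) = F (k_part \<theta> L + A) X"
      using form_sym[of "k_part \<theta> X"] form_k_left[of "k_part \<theta> L" X] form_p_left[OF A, of X]
      by simp
  qed
  finally have "frechet_derivative (affine_hamiltonian F \<theta> A) (at L) = F (k_part \<theta> L + A)"
    by (rule frechet_derivative_at[symmetric])
  then show ?thesis
    unfolding gradient_def by (intro the_equality) (simp, intro form_eqI, simp)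
qed

text \<open>Solves the weak form of the equations for the velocity. Each term of the deformed
  bracket is moved across \<open>F\<close> by invariance; orthogonality inserts or drops projections
  according to the eigenspace in which a bracket lies.\<close>

lemma hamiltonian_vector_eq:
  assumes A: "A \<in> p_subspace \<theta>"
    and V: "\<And>X. F V X = - F L (deformed_bracket br \<theta> s (k_part \<theta> L + A) X)"
  shows "V = br (k_part \<theta> L) (p_part \<theta> L - s *\<^sub>R A) + br A (p_part \<theta> L)"
proof (rule form_eqI)
  fix X
  let ?p = "p_part \<theta>" and ?k = "k_part \<theta>"
  have "deformed_bracket br \<theta> s (?k L + A) X
      = br (?k L) (?p X) - br (?k X) A + br (?k L) (?k X) + s *\<^sub>R br A (?p X)"
    using A by (simp add: deformed_bracket_def)
  moreover have "F L (br (?k L) (?p X)) = F (br (?p L) (?k L)) X"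
    using form_p_right[OF br_kp[OF k_part_in p_part_in]] form_p_left[OF br_pk[OF p_part_in k_part_in]]
      form_invariant by metis
  moreover have "F L (br (?k X) A) = - F (br (?p L) A) X"
  proof -
    have "F L (br (?k X) A) = F (?p L) (br (?k X) A)"
      by (rule form_p_right[OF br_kp[OF k_part_in A]])
    also have "\<dots> = - F (br (?p L) A) (?k X)"
      using br_swap[of "?k X" A] by (simp add: form_invariant)
    finally show ?thesis
      using form_k_left[OF br_pp[OF p_part_in A]] by metis
  qed
  \<comment> \<open>Only the \<open>k_part\<close> of \<open>L\<close> pairs with this bracket, and
    invariance then produces the bracket of \<open>?k L\<close> with itself.\<close>
  moreover have "F L (br (?k L) (?k X)) = 0"
    using form_k_right[OF br_kk[OF k_part_in k_part_in]] form_invariant[of "?k L" "?k L" "?k X"]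
    by simp
  moreover have "F L (br A (?p X)) = F (br (?k L) A) X"
    using form_k_right[OF br_pp[OF A p_part_in]] form_p_left[OF br_kp[OF k_part_in A]]
      form_invariant by metis
  ultimately have "F L (deformed_bracket br \<theta> s (?k L + A) X)
      = F (br (?p L) (?k L)) X + F (br (?p L) A) X + s * F (br (?k L) A) X"
    by simp
  then show "F V X = F (br (?k L) (?p L - s *\<^sub>R A) + br A (?p L)) X"
    using V[of X] br_swap[of "?p L" "?k L"] br_swap[of "?p L" A]
    by (simp add: right_diff_distrib)
qed

text \<open>With \<open>M = Lax_M\<close> one has \<open>L\<^sub>\<lambda> = \<lambda> M - \<lambda>
  L\<^sub>k + \<lambda>^2 A\<close>. The first summand commutes with \<open>M\<close>, which removes
  the pole in \<open>\<lambda>\<close>; the others give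
  \<open>[L\<^sub>k, L\<^sub>p - s A] - \<lambda> [A, L\<^sub>p]\<close>.\<close>

lemma Lax_equation_pointwise:
  assumes A: "A \<in> p_subspace \<theta>" and lam: "lam \<noteq> 0"
    and V: "V = br (k_part \<theta> L) (p_part \<theta> L - s *\<^sub>R A) + br A (p_part \<theta> L)"
  shows "p_part \<theta> V - lam *\<^sub>R k_part \<theta> V = br (Lax_M \<theta> A s lam L) (Lax_L \<theta> A s lam L)"
proof -
  let ?p = "p_part \<theta> L" and ?k = "k_part \<theta> L"
  have "br ?k ?p \<in> p_subspace \<theta>" "br ?k A \<in> p_subspace \<theta>" "br A ?p \<in> k_subspace \<theta>"
    using A by (auto intro: br_kp br_pp)
  then have "p_part \<theta> V - lam *\<^sub>R k_part \<theta> V = br ?k ?p - s *\<^sub>R br ?k A - lam *\<^sub>R br A ?p"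
    by (simp add: V)
  also have "\<dots> = br (Lax_M \<theta> A s lam L) (Lax_L \<theta> A s lam L)"
    using lam br_swap[of ?p ?k] br_swap[of ?p A] br_swap[of A ?k]
    by (simp add: Lax_M_def Lax_L_def algebra_simps power2_eq_square)
  finally show ?thesis .
qed

lemma Lax_equation:
  assumes A: "A \<in> p_subspace \<theta>" and lam: "lam \<noteq> 0"
    and sol: "hamiltonian_solution F (deformed_bracket br \<theta> s) (affine_hamiltonian F \<theta> A) I L"
    and t: "t \<in> I"
  shows "((\<lambda>u. Lax_L \<theta> A s lam (L u)) has_vector_derivative
      br (Lax_M \<theta> A s lam (L t)) (Lax_L \<theta> A s lam (L t))) (at t within I)"
proof -
  obtain V where der: "(L has_vector_derivative V) (at t within I)"
    and V: "\<And>X. F V X = - F (L t) (deformed_bracket br \<theta> s (k_part \<theta> (L t) + A) X)"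
    using sol t by (auto simp: hamiltonian_solution_def gradient_affine_hamiltonian[OF A])
  have "((\<lambda>u. p_part \<theta> (L u) - lam *\<^sub>R k_part \<theta> (L u) + (lam\<^sup>2 - s) *\<^sub>R A) has_vector_derivative
      (p_part \<theta> V - lam *\<^sub>R k_part \<theta> V + 0)) (at t within I)"
    using linear_p_part linear_k_part
    by (intro has_vector_derivative_add has_vector_derivative_diff has_vector_derivative_const
        bounded_linear.has_vector_derivative[OF bounded_linear_scaleR_right]
        bounded_linear.has_vector_derivative[OF _ der])
      (simp_all add: linear_conv_bounded_linear)
  then show ?thesis
    using Lax_equation_pointwise[OF A lam hamiltonian_vector_eq[OF A V]] by (simp add: Lax_L_def)
qed

end

section \<open>The tangent map of an involution\<close>

lemma smooth_on_imp_differentiable_on: "smooth_on S f \<Longrightarrow> f differentiable_on S"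
  unfolding smooth_on_def by (drule spec[of _ "Suc 0"]) simp

text \<open>In the chart \<open>\<sigma>\<close> becomes a map \<open>f\<close> that fixes the base
  point and is its own inverse near it, so the chain rule makes the square of its derivative the
  identity. Smoothness is what ties \<open>frechet_derivative\<close> to an actual
  derivative.\<close>

lemma tangent_map_involution:
  fixes G :: "('g, 'm) monoid_scheme" and c :: "('g, 'a::euclidean_space) chart"
  assumes lie: "lie_group G T \<A>" and c: "c \<in> \<A>" "\<one>\<^bsub>G\<^esub> \<in> fst c"
    and inv: "involutive_lie_automorphism G T \<A> \<sigma>"
  shows "linear (tangent_map G c \<sigma>)"
    and "tangent_map G c \<sigma> (tangent_map G c \<sigma> X) = X"
proof -
  obtain U \<phi> where c_eq: "c = (U, \<phi>)" by (cases c)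
  let ?\<psi> = "inv_into U \<phi>" and ?e = "\<phi> \<one>\<^bsub>G\<^esub>" and ?S = "\<phi> ` {x \<in> U. \<sigma> x \<in> U}"
  define f where "f = \<phi> \<circ> \<sigma> \<circ> ?\<psi>"
  have G: "group G" and top: "topspace T = carrier G" and atlas: "smooth_atlas T \<A>"
    using lie by (auto simp: lie_group_def smooth_manifold_def)
  have \<sigma>: "\<sigma> \<in> hom G G" "smooth_map T \<A> \<sigma>" "\<And>x. x \<in> carrier G \<Longrightarrow> \<sigma> (\<sigma> x) = x"
    using inv by (auto simp: involutive_lie_automorphism_def iso_def)
  have U: "openin T U" "open (\<phi> ` U)" "homeomorphic_map (subtopology T U) (top_of_set (\<phi> ` U)) \<phi>"
    using atlas c by (auto simp: smooth_atlas_def c_eq)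
  have UG: "U \<subseteq> carrier G"
    using openin_subset[OF U(1)] top by simp
  then have "topspace (subtopology T U) = U"
    using top by auto
  then have inj: "inj_on \<phi> U"
    using homeomorphic_imp_injective_map[OF U(3)] by simp
  have one: "\<sigma> \<one>\<^bsub>G\<^esub> = \<one>\<^bsub>G\<^esub>"
    using hom_one[OF \<sigma>(1) G G] .
  have f_\<phi>: "f (\<phi> x) = \<phi> (\<sigma> x)" if "x \<in> U" for x
    using that inj by (simp add: f_def)
  have e: "?e \<in> ?S" "f ?e = ?e"
    using c(2) one by (auto simp: c_eq f_\<phi>)
  \<comment> \<open>Openness of \<open>?S\<close>, where \<open>f\<close> stays inside the chart:
    pull \<open>U\<close> back along the continuous \<open>\<sigma>\<close>, then push forward by
    the chart, which is an open map onto an open set.\<close>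
  have "openin T {x \<in> topspace T. \<sigma> x \<in> U}"
    using \<sigma>(2) U(1) by (auto simp: smooth_map_def continuous_map_def)
  then have "openin T (U \<inter> {x \<in> topspace T. \<sigma> x \<in> U})"
    using U(1) by blast
  moreover have "U \<inter> {x \<in> topspace T. \<sigma> x \<in> U} = {x \<in> U. \<sigma> x \<in> U}"
    using UG top by auto
  ultimately have "openin (subtopology T U) {x \<in> U. \<sigma> x \<in> U}"
    using U(1) by (auto simp: openin_open_subtopology)
  then have "openin (top_of_set (\<phi> ` U)) ?S"
    using homeomorphic_imp_open_map[OF U(3)] by (simp add: open_map_def)
  then have S: "open ?S"
    using U(2) openin_open_trans by blast
  have "smooth_on ?S f"
    using \<sigma>(2) c(1) by (auto simp: smooth_map_def c_eq f_def)
  then have "f differentiable (at ?e)"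
    using smooth_on_imp_differentiable_on[of ?S f] e(1) differentiable_on_eq_differentiable_at[OF S]
    by (metis (no_types))
  then have der: "(f has_derivative tangent_map G c \<sigma>) (at ?e)"
    by (simp add: tangent_map_def c_eq f_def frechet_derivative_works[symmetric])
  then show "linear (tangent_map G c \<sigma>)"
    by (rule has_derivative_linear)
  have "f (f y) = y" if "y \<in> ?S" for y
    using that \<sigma>(3) UG by (auto simp: f_\<phi>)
  then have "((\<lambda>y. f (f y)) has_derivative (\<lambda>y. y)) (at ?e)"
    using S e(1) by (intro has_derivative_transform_within_open[OF has_derivative_ident]) auto
  moreover have "((\<lambda>y. f (f y)) has_derivative (\<lambda>X. tangent_map G c \<sigma> (tangent_map G c \<sigma> X))) (at ?e)"
    using has_derivative_compose[OF der, of f "tangent_map G c \<sigma>"] der e(2) by simp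
  ultimately show "tangent_map G c \<sigma> (tangent_map G c \<sigma> X) = X"
    using has_derivative_unique[of "\<lambda>y. f (f y)" "\<lambda>y. y" ?e
        "\<lambda>X. tangent_map G c \<sigma> (tangent_map G c \<sigma> X)"] by (simp add: fun_eq_iff)
qed

section \<open>The Lax pair\<close>

text \<open>Everything but nondegeneracy passes from the Killing form to any multiple of it;
  nondegeneracy follows from semisimplicity once \<open>r\<close> is nonzero.\<close>

lemma symmetric_lie_algebra_form_of_killing_form:
  assumes "symmetric_lie_algebra br \<theta>" and ss: "semisimple br"
    and pk: "bracket_space br (p_subspace \<theta>) (k_subspace \<theta>) = p_subspace \<theta>"
    and F: "\<And>X Y. F X Y = r * killing_form br X Y"
    and pos: "\<And>X. X \<in> k_subspace \<theta> \<Longrightarrow> X \<noteq> 0 \<Longrightarrow> F X X > 0"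
  shows "symmetric_lie_algebra_form br \<theta> F"
proof -
  interpret symmetric_lie_algebra br \<theta> by fact
  \<comment> \<open>If \<open>r = 0\<close> then \<open>F\<close> vanishes, and positivity leaves
    only zero in \<open>k_subspace \<theta>\<close>. As \<open>p_subspace \<theta>\<close> is
    spanned by brackets with that space, it is zero too, whereas a Euclidean space contains a
    nonzero basis vector.\<close>
  have "r \<noteq> 0"
  proof
    assume "r = 0"
    then have k: "k_subspace \<theta> \<subseteq> {0}"
      using F pos by (intro subsetI) (metis less_irrefl mult_zero_left singletonI)
    then have "{br X Y |X Y. X \<in> p_subspace \<theta> \<and> Y \<in> k_subspace \<theta>} \<subseteq> {0}"
      by auto
    then have p: "p_subspace \<theta> \<subseteq> {0}"
      using span_minimal[of _ "{0}"] by (subst pk[symmetric]) (simp add: bracket_space_def)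
    have "X = 0" for X :: 'a
    proof -
      have "p_part \<theta> X = 0" "k_part \<theta> X = 0"
        using subsetD[OF p p_part_in] subsetD[OF k k_part_in] by simp_all
      then show ?thesis
        using parts[of X] by simp
    qed
    then show False
      using nonempty_Basis nonzero_Basis by blast
  qed
  note killing_simps = bilinear_ladd[OF bilinear_killing_form] bilinear_radd[OF bilinear_killing_form]
    bilinear_lmul[OF bilinear_killing_form] bilinear_rmul[OF bilinear_killing_form]
  show ?thesis
  proof unfold_locales
    show "bilinear F"
      unfolding bilinear_def
      by (intro conjI allI linearI) (simp_all add: F killing_simps distrib_left)
    show "X = 0" if "\<And>Y. F X Y = 0" for X
      using that \<open>r \<noteq> 0\<close> ss by (simp add: F semisimple_def)
    show "F X Y = F Y X" for X Y
      using killing_form_sym[of X Y] by (simp add: F)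
  qed (simp_all add: F killing_form_invariant killing_form_theta)
qed

theorem mainTheorem2:
  fixes G :: "('g, 'm) monoid_scheme"
    and T :: "'g topology"
    and \<A> :: "('g, 'a::euclidean_space) chart set"
    and c :: "('g, 'a) chart"
    and br :: "'a \<Rightarrow> 'a \<Rightarrow> 'a"
    and \<sigma> :: "'g \<Rightarrow> 'g"
    and \<theta> :: "'a \<Rightarrow> 'a"
    and F :: "'a \<Rightarrow> 'a \<Rightarrow> real"
    and A :: 'a and s :: real and H :: "'a \<Rightarrow> real"
  assumes "lie_group G T \<A>" and "connected_space T"
    and "c \<in> \<A>" and "\<one>\<^bsub>G\<^esub> \<in> fst c"
    and "lie_algebra_of G c br" and "semisimple br"
    and "involutive_lie_automorphism G T \<A> \<sigma>" and "\<exists>x\<in>carrier G. \<sigma> x \<noteq> x"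
    and "compactin T (fixed_points G \<sigma>)"
    and "riemannian_symmetric_pair G T c (fixed_points G \<sigma>) \<sigma>"
    and "\<theta> = tangent_map G c \<sigma>"
    and "bracket_space br (p_subspace \<theta>) (p_subspace \<theta>) = k_subspace \<theta>"
    and "bracket_space br (p_subspace \<theta>) (k_subspace \<theta>) = p_subspace \<theta>"
    and "bracket_space br (k_subspace \<theta>) (k_subspace \<theta>) \<subseteq> k_subspace \<theta>"
    and "\<exists>r. \<forall>X Y. F X Y = r * killing_form br X Y"
    and "\<forall>X\<in>k_subspace \<theta>. X \<noteq> 0 \<longrightarrow> F X X > 0"
    and "regular_element br \<theta> A"
    and "s \<in> {0, 1}"
    and "H = affine_hamiltonian F \<theta> A"
  shows "(\<forall>I L lam. hamiltonian_solution F (deformed_bracket br \<theta> s) H I L \<longrightarrow> lam \<noteq> 0 \<longrightarrow>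
            (\<forall>t\<in>I. ((\<lambda>u. Lax_L \<theta> A s lam (L u)) has_vector_derivative
                br (Lax_M \<theta> A s lam (L t)) (Lax_L \<theta> A s lam (L t))) (at t within I)))
       \<and> (\<forall>lam n i. \<forall>\<rho> :: 'a \<Rightarrow> 'f::real_normed_field mat.
            lam \<noteq> 0 \<longrightarrow> matrix_realization br n \<rho> \<longrightarrow>
            constant_of_motion F (deformed_bracket br \<theta> s) H
              (\<lambda>L. coeff (char_poly (\<rho> (Lax_L \<theta> A s lam L))) i))
       \<and> (\<forall>lam i bs. lam \<noteq> 0 \<longrightarrow> ordered_basis bs \<longrightarrow>
            constant_of_motion F (deformed_bracket br \<theta> s) H
              (\<lambda>L. coeff (char_poly (matrix_of_map bs (br (Lax_L \<theta> A s lam L)))) i))"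
proof -
  interpret lie_bracket br
    using assms(5) by unfold_locales (simp add: lie_algebra_of_def)
  have theta: "linear \<theta>" "\<And>X. \<theta> (\<theta> X) = X"
    unfolding \<open>\<theta> = tangent_map G c \<sigma>\<close>
    using tangent_map_involution[OF assms(1,3,4,7)] by blast+
  \<comment> \<open>The assumptions are about spans of brackets; single brackets, as the locale
    wants them, are among the generators.\<close>
  have in_bracket_space: "br X Y \<in> bracket_space br S S'" if "X \<in> S" "Y \<in> S'" for X Y S S'
    using that unfolding bracket_space_def by (intro span_base) auto
  have sym: "symmetric_lie_algebra br \<theta>"
  proof unfold_locales
    show "br X Y \<in> k_subspace \<theta>" if "X \<in> p_subspace \<theta>" "Y \<in> p_subspace \<theta>" for X Y
      using in_bracket_space[OF that] assms(12) by simp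
    show "br X Y \<in> p_subspace \<theta>" if "X \<in> p_subspace \<theta>" "Y \<in> k_subspace \<theta>" for X Y
      using in_bracket_space[OF that] assms(13) by simp
    show "br X Y \<in> k_subspace \<theta>" if "X \<in> k_subspace \<theta>" "Y \<in> k_subspace \<theta>" for X Y
      using in_bracket_space[OF that] assms(14) by blast
  qed (use theta in \<open>simp_all add: linear_add linear_scale\<close>)
  obtain r where r: "\<And>X Y. F X Y = r * killing_form br X Y"
    using assms(15) by blast
  interpret symmetric_lie_algebra_form br \<theta> F
    using symmetric_lie_algebra_form_of_killing_form[OF sym assms(6,13) r] assms(16) by blast
  have A: "A \<in> p_subspace \<theta>"
    using assms(17) by (simp add: regular_element_def)
  note Lax = Lax_equation[OF A, of _ s, folded assms(19)]
  show ?thesis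
  proof (intro conjI allI impI ballI)
    fix lam :: real and n i and \<rho> :: "'a \<Rightarrow> 'f mat"
    assume lam: "lam \<noteq> 0" and \<rho>: "matrix_realization br n \<rho>"
    show "constant_of_motion F (deformed_bracket br \<theta> s) H
        (\<lambda>L. coeff (char_poly (\<rho> (Lax_L \<theta> A s lam L))) i)"
      unfolding constant_of_motion_def
    proof (intro allI impI ballI)
      fix I L t u
      assume sol: "hamiltonian_solution F (deformed_bracket br \<theta> s) H I L" and "t \<in> I" "u \<in> I"
      then have "char_poly (\<rho> (Lax_L \<theta> A s lam (L t))) = char_poly (\<rho> (Lax_L \<theta> A s lam (L u)))"
        by (intro char_poly_constant_of_Lax_equation[where br = br and \<rho> = \<rho> and n = n and I = I
              and L = "\<lambda>t. Lax_L \<theta> A s lam (L t)" and M = "\<lambda>t. Lax_M \<theta> A s lam (L t)"])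
          (use \<rho> Lax[OF lam sol] in \<open>auto simp: matrix_realization_def hamiltonian_solution_def\<close>)
      then show "coeff (char_poly (\<rho> (Lax_L \<theta> A s lam (L t)))) i
          = coeff (char_poly (\<rho> (Lax_L \<theta> A s lam (L u)))) i"
        by simp
    qed
  next
    fix lam :: real and i and bs :: "'a list"
    assume lam: "lam \<noteq> 0" and bs: "ordered_basis bs"
    show "constant_of_motion F (deformed_bracket br \<theta> s) H
        (\<lambda>L. coeff (char_poly (matrix_of_map bs (br (Lax_L \<theta> A s lam L)))) i)"
      unfolding constant_of_motion_def
    proof (intro allI impI ballI)
      fix I L t u
      assume sol: "hamiltonian_solution F (deformed_bracket br \<theta> s) H I L" and t: "t \<in> I" and u: "u \<in> I"
      have I: "is_interval I"
        using sol by (simp add: hamiltonian_solution_def)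
      show "coeff (char_poly (matrix_of_map bs (br (Lax_L \<theta> A s lam (L t))))) i
          = coeff (char_poly (matrix_of_map bs (br (Lax_L \<theta> A s lam (L u))))) i"
        using char_poly_adjoint_constant[OF bs I Lax[OF lam sol] t u] by simp
    qed
  qed (rule Lax)
qed

end
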